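(* Let $\rho>0$ be a fixed constant. There is a constant $C$ depending only on $\rho$ such that for every distribution $\mathcal{P}$ over truthful-auction requests and every horizon $T\ge2$, when the requests $\gamma_1,\dots,\gamma_T$ are drawn i.i.d. from $\mathcal{P}$, the bidding algorithm Algorithm A (defined in the context) run with horizon $T$ and total budget $\rho T$ satisfies $$\mathrm{Regret}(\text{Algorithm A},\mathcal{P}^T)\le C\sqrt T .$$ Further, for every realization of the request sequence, the bids $b_1,\dots,b_T$ of Algorithm A incur a violation of at most $C\sqrt T\log T$ of the return-on-spend constraint and no violation of the budget constraint, that is, $$\sum_{t=1}^T p_t(b_t)-\sum_{t=1}^T v_t\cdot x_t(b_t)\le C\sqrt T\log T\qquad\text{and}\qquad\sum_{t=1}^T p_t(b_t)\le\rho T .$$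
   Context: Requests. A request is a tuple $\gamma=(v,x,p)$ with value $v\in[0,1]$, non-decreasing allocation function $x:\mathbb{R}_{\ge 0}\to[0,1]$, and payment function $p:\mathbb{R}_{\ge 0}\to[0,1]$ satisfying $p(b)=b\,x(b)-\int_0^b x(z)\,dz$ (truthful auction). Over $T$ rounds requests $\gamma_t=(v_t,x_t,p_t)$ arrive. In round $t$ the bidder sees $v_t$, chooses a bid $b_t\ge 0$, then observes $x_t(b_t)$ and $p_t(b_t)$. Put $g_t(b)=v_t\,x_t(b)-p_t(b)$. Problem. Maximize $\sum_{t=1}^T v_t x_t(b_t)$ over bids $b_t\ge0$ subject to the return-on-spend (RoS) constraint $\sum_{t=1}^T p_t(b_t)\le\sum_{t=1}^T v_t x_t(b_t)$ and the budget constraint $\sum_{t=1}^T p_t(b_t)\le\rho T$. For a request sequence $\vec\gamma$, $\mathrm{Reward}(\mathrm{Opt},\vec\gamma)$ is the optimal (supremum) value of this problem, in hindsight. For an algorithm Alg producing bids $b_t$, $\mathrm{Reward}(\mathrm{Alg},\vec\gamma)=\sum_{t=1}^T v_t x_t(b_t)$, and $\mathrm{Regret}(\mathrm{Alg},\mathcal{P}^T)=\mathbb{E}_{\vec\gamma\sim\mathcal{P}^T}[\mathrm{Reward}(\mathrm{Opt},\vec\gamma)-\mathrm{Reward}(\mathrm{Alg},\vec\gamma)]$. Algorithm A (horizon $T$, total budget $\rho T$). Set $\lambda_1=1$, $\mu_1=0$, $B_1=\rho T$, $\alpha=1/\sqrt T$, $\eta=1/((1+\rho^2)\sqrt T)$.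 For $t=1,\dots,T$: observe $v_t$; bid $b_t=\frac{1+\lambda_t}{\mu_t+\lambda_t}v_t$ if $B_t\ge1$ and $b_t=0$ otherwise; set $\lambda_{t+1}=\lambda_t\exp(-\alpha g_t(b_t))$, $\mu_{t+1}=\max(0,\mu_t-\eta(\rho-p_t(b_t)))$, $B_{t+1}=B_t-p_t(b_t)$. *)

theory Defs
  imports "HOL-Probability.Probability"
begin

section \<open>Requests\<close>

text \<open>
  The allocation and payment functions live on the nonnegative reals; they are represented by
  total functions on the reals whose values at negative arguments are never looked at.
\<close>

datatype request = Request (val: real) (alloc: "real \<Rightarrow> real") (pay: "real \<Rightarrow> real")

definition truthful :: "request \<Rightarrow> bool" where
  "truthful \<gamma> \<longleftrightarrow>
     val \<gamma> \<in> {0..1} \<and>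
     mono_on {0..} (alloc \<gamma>) \<and>
     (\<forall>b\<ge>0. alloc \<gamma> b \<in> {0..1} \<and> pay \<gamma> b \<in> {0..1} \<and>
            pay \<gamma> b = b * alloc \<gamma> b - integral {0..b} (alloc \<gamma>))"

text \<open>
  A distribution over requests. The sigma-algebra on requests is arbitrary, subject to the two
  conditions without which the reward of a bidding algorithm is not a random variable:
  the value is measurable, and evaluating the allocation at a bid is jointly measurable in the
  request and the bid. (Measurability of each single evaluation \<open>\<gamma> \<mapsto> x(b)\<close> would not
  suffice, since allocations may jump and bids are random.) Joint measurability of the payment
  follows from the payment formula.
\<close>

definition request_distribution :: "request measure \<Rightarrow> bool" where
  "request_distribution P \<longleftrightarrow>
     prob_space P \<and>
     (\<forall>\<gamma>\<in>space P. truthful \<gamma>) \<and>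
     val \<in> borel_measurable P \<and>
     (\<lambda>(\<gamma>, b). alloc \<gamma> b) \<in> borel_measurable (P \<Otimes>\<^sub>M restrict_space borel {0..})"


section \<open>The bidding problem\<close>

text \<open>Rounds are numbered \<open>0, \<dots>, T - 1\<close> instead of \<open>1, \<dots>, T\<close>.\<close>

definition total_value :: "nat \<Rightarrow> (nat \<Rightarrow> request) \<Rightarrow> (nat \<Rightarrow> real) \<Rightarrow> real" where
  "total_value T \<gamma> b = (\<Sum>t<T. val (\<gamma> t) * alloc (\<gamma> t) (b t))"

definition total_payment :: "nat \<Rightarrow> (nat \<Rightarrow> request) \<Rightarrow> (nat \<Rightarrow> real) \<Rightarrow> real" where
  "total_payment T \<gamma> b = (\<Sum>t<T. pay (\<gamma> t) (b t))"

definition feasible :: "real \<Rightarrow> nat \<Rightarrow> (nat \<Rightarrow> request) \<Rightarrow> (nat \<Rightarrow> real) \<Rightarrow> bool" where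
  "feasible \<rho> T \<gamma> b \<longleftrightarrow>
     (\<forall>t<T. b t \<ge> 0) \<and>
     total_payment T \<gamma> b \<le> total_value T \<gamma> b \<and>
     total_payment T \<gamma> b \<le> \<rho> * real T"

definition reward_opt :: "real \<Rightarrow> nat \<Rightarrow> (nat \<Rightarrow> request) \<Rightarrow> real" where
  "reward_opt \<rho> T \<gamma> = Sup {total_value T \<gamma> b | b. feasible \<rho> T \<gamma> b}"


section \<open>Expectation and regret\<close>

text \<open>
  The hindsight optimum is a supremum over uncountably many bid vectors, so it need not be
  measurable with respect to the product sigma-algebra itself. The Bochner integral is 0 on
  non-integrable functions, which would make bounds on it meaningless there; the upper expectation
  below has no such default value. It is the ordinary expectation whenever that exists, even if
  only with respect to the completion of the measure.
\<close>

definition upper_expectation :: "'a measure \<Rightarrow> ('a \<Rightarrow> real) \<Rightarrow> real" where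
  "upper_expectation M f = Inf {integral\<^sup>L M Z | Z. integrable M Z \<and> (AE \<omega> in M. f \<omega> \<le> Z \<omega>)}"

lemma upper_expectation_eq_integral_completion:
  assumes f: "integrable (completion M) f"
  shows "upper_expectation M f = integral\<^sup>L (completion M) f"
proof -
  let ?S = "{integral\<^sup>L M Z | Z. integrable M Z \<and> (AE \<omega> in M. f \<omega> \<le> Z \<omega>)}"
  obtain g where g: "g \<in> borel_measurable M" and fg: "AE x in M. f x = g x"
    using completion_ex_borel_measurable_real[of f M] f by (auto simp: integrable_iff_bounded)
  have fg': "AE x in completion M. f x = g x"
    using fg by (rule AE_completion)
  have gc: "g \<in> borel_measurable (completion M)"
    using g by (rule measurable_completion)
  have int_g: "integrable (completion M) g"
    using f integrable_cong_AE[OF _ gc fg'] by auto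
  have eq: "integral\<^sup>L (completion M) f = integral\<^sup>L M g"
    using integral_cong_AE[OF _ gc fg'] f integral_completion[OF g] by auto
  have "integrable M g"
    using int_g integrable_completion[OF g] by simp
  moreover have "AE x in M. f x \<le> g x"
    using fg by eventually_elim simp
  ultimately have "integral\<^sup>L (completion M) f \<in> ?S"
    using eq by blast
  moreover have "integral\<^sup>L (completion M) f \<le> z" if in_S: "z \<in> ?S" for z
  proof -
    obtain Z where z: "z = integral\<^sup>L M Z" and Z: "integrable M Z" "AE \<omega> in M. f \<omega> \<le> Z \<omega>"
      using in_S by blast
    have "AE x in M. g x \<le> Z x"
      using Z(2) fg by eventually_elim simp
    then have "integral\<^sup>L M g \<le> integral\<^sup>L M Z"
      using \<open>integrable M g\<close> Z(1) by (intro integral_mono_AE)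
    then show ?thesis
      using eq z by simp
  qed
  ultimately show ?thesis
    unfolding upper_expectation_def by (intro cInf_eq_minimum)
qed

lemma upper_expectation_eq_integral:
  assumes "integrable M f"
  shows "upper_expectation M f = integral\<^sup>L M f"
proof -
  have m: "f \<in> borel_measurable M"
    using assms by simp
  show ?thesis
    using assms upper_expectation_eq_integral_completion[of M f]
      integrable_completion[OF m] integral_completion[OF m] by simp
qed

text \<open>
  A bidding algorithm, for fixed horizon and budget, maps the request sequence to its bids;
  \<open>T\<close> i.i.d. requests are an element of the \<open>T\<close>-fold product of \<open>P\<close>.
\<close>

definition regret ::
  "((nat \<Rightarrow> request) \<Rightarrow> nat \<Rightarrow> real) \<Rightarrow> real \<Rightarrow> nat \<Rightarrow> request measure \<Rightarrow> real" where
  "regret alg \<rho> T P =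
     upper_expectation (Pi\<^sub>M {..<T} (\<lambda>_. P)) (\<lambda>\<gamma>. reward_opt \<rho> T \<gamma> - total_value T \<gamma> (alg \<gamma>))"


section \<open>The algorithm\<close>

definition net_gain :: "request \<Rightarrow> real \<Rightarrow> real" where
  "net_gain \<gamma> b = val \<gamma> * alloc \<gamma> b - pay \<gamma> b"

text \<open>The state is the triple \<open>(\<lambda>, \<mu>, B)\<close> of the two dual variables and the remaining budget.\<close>

fun bid :: "real \<times> real \<times> real \<Rightarrow> real \<Rightarrow> real" where
  "bid (l, m, B) v = (if B \<ge> 1 then (1 + l) / (m + l) * v else 0)"

fun update :: "real \<Rightarrow> nat \<Rightarrow> request \<Rightarrow> real \<times> real \<times> real \<Rightarrow> real \<times> real \<times> real" where
  "update \<rho> T \<gamma> (l, m, B) =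
     (let b = bid (l, m, B) (val \<gamma>);
          \<alpha> = 1 / sqrt (real T);
          \<eta> = 1 / ((1 + \<rho>\<^sup>2) * sqrt (real T))
      in (l * exp (- \<alpha> * net_gain \<gamma> b),
          max 0 (m - \<eta> * (\<rho> - pay \<gamma> b)),
          B - pay \<gamma> b))"

text \<open>The state at the beginning of round \<open>t\<close>; it depends only on the requests before \<open>t\<close>.\<close>

primrec state :: "real \<Rightarrow> nat \<Rightarrow> (nat \<Rightarrow> request) \<Rightarrow> nat \<Rightarrow> real \<times> real \<times> real" where
  "state \<rho> T \<gamma> 0 = (1, 0, \<rho> * real T)"
| "state \<rho> T \<gamma> (Suc t) = update \<rho> T (\<gamma> t) (state \<rho> T \<gamma> t)"

definition algorithm_A :: "real \<Rightarrow> nat \<Rightarrow> (nat \<Rightarrow> request) \<Rightarrow> nat \<Rightarrow> real" where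
  "algorithm_A \<rho> T \<gamma> t = bid (state \<rho> T \<gamma> t) (val (\<gamma> t))"

end

theory Submission
  imports Defs
begin

text \<open>
  For multipliers \<open>\<lambda>\<close> and \<open>\<mu>\<close> of the two constraints, truthfulness makes the bid
  \<open>(1 + \<lambda>) / (\<mu> + \<lambda>) * v\<close> maximize the Lagrangian of a single request. Let \<open>D\<close> be the infimum over
  \<open>\<lambda>\<close> and \<open>\<mu>\<close> of the expected maximum. By weak duality the hindsight optimum is
  at most \<open>T * D\<close> in expectation, and since the multipliers of a round are independent of its request,
  every round before the budget runs out has a maximal Lagrangian of mean at least \<open>D\<close>. The value collected
  differs from these Lagrangians by the two constraint terms, which are the regrets of two online
  learners. For \<open>\<mu>\<close> this is projected gradient descent, and its comparator \<open>1 / \<rho>\<close> also pays for the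
  rounds after the budget has run out because \<open>D \<le> 1\<close>. For \<open>\<lambda>\<close> it is multiplicative weights, where the
  bid guarantees \<open>\<lambda>\<^sub>t * g\<^sub>t \<ge> -1\<close>; hence \<open>\<lambda>\<close> grows by at most \<open>2 / sqrt T\<close> per round. As the RoS violation
  equals \<open>sqrt T\<close> times the logarithm of the final \<open>\<lambda>\<close>, it is of order \<open>sqrt T * ln T\<close>.
\<close>

section \<open>The Lagrangian of a request\<close>

text \<open>This is \<open>v x + l (v x - p) + m (\<rho> - p)\<close> regrouped: the reward plus the
  slacks of the RoS and the per-round budget constraint, weighted by \<open>l\<close> and
  \<open>m\<close>.\<close>

definition lagrangian :: "real \<Rightarrow> real \<Rightarrow> real \<Rightarrow> request \<Rightarrow> real \<Rightarrow> real" where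
  "lagrangian \<rho> l m \<gamma> b = (1 + l) * (val \<gamma> * alloc \<gamma> b) - (l + m) * pay \<gamma> b + m * \<rho>"

definition dual_bid :: "real \<Rightarrow> real \<Rightarrow> real \<Rightarrow> real" where
  "dual_bid l m v = (1 + l) / (m + l) * v"

definition dual_value :: "real \<Rightarrow> real \<Rightarrow> real \<Rightarrow> request \<Rightarrow> real" where
  "dual_value \<rho> l m \<gamma> = lagrangian \<rho> l m \<gamma> (dual_bid l m (val \<gamma>))"

section \<open>Incentive compatibility and the loss from overbidding\<close>

lemma integral_mono_on_bounds:
  fixes f :: "real \<Rightarrow> real"
  assumes "mono_on {a..b} f" "a \<le> b"
  shows "(b - a) * f a \<le> integral {a..b} f" "integral {a..b} f \<le> (b - a) * f b"
proof -
  have int: "f integrable_on {a..b}"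
    using assms(1) by (rule integrable_on_mono_on)
  have "integral {a..b} (\<lambda>_. f a) \<le> integral {a..b} f"
    by (rule integral_le) (use int assms in \<open>auto simp: mono_on_def\<close>)
  then show "(b - a) * f a \<le> integral {a..b} f"
    using assms(2) by simp
  have "integral {a..b} f \<le> integral {a..b} (\<lambda>_. f b)"
    by (rule integral_le) (use int assms in \<open>auto simp: mono_on_def\<close>)
  then show "integral {a..b} f \<le> (b - a) * f b"
    using assms(2) by simp
qed

lemma truthful_bounds:
  assumes "truthful \<gamma>" "0 \<le> b"
  shows "0 \<le> val \<gamma>" "val \<gamma> \<le> 1" "0 \<le> alloc \<gamma> b" "alloc \<gamma> b \<le> 1"
    "0 \<le> pay \<gamma> b" "pay \<gamma> b \<le> 1" "0 \<le> val \<gamma> * alloc \<gamma> b" "val \<gamma> * alloc \<gamma> b \<le> 1"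
proof -
  show *: "0 \<le> val \<gamma>" "val \<gamma> \<le> 1" "0 \<le> alloc \<gamma> b" "alloc \<gamma> b \<le> 1" "0 \<le> pay \<gamma> b" "pay \<gamma> b \<le> 1"
    using assms unfolding truthful_def atLeastAtMost_iff by blast+
  show "0 \<le> val \<gamma> * alloc \<gamma> b" "val \<gamma> * alloc \<gamma> b \<le> 1"
    using * by (auto intro: mult_nonneg_nonneg mult_le_one)
qed

lemma truthful_pay_zero:
  assumes "truthful \<gamma>"
  shows "pay \<gamma> 0 = 0"
proof -
  have "pay \<gamma> 0 = 0 * alloc \<gamma> 0 - integral {0..0} (alloc \<gamma>)"
    using assms unfolding truthful_def by blast
  then show ?thesis by simp
qed

text \<open>By the payment formula the utility of value \<open>c\<close> is the integral of the
  allocation up to \<open>c\<close> when bidding \<open>c\<close>, and the integral up to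
  \<open>b\<close> plus \<open>(c - b) x(b)\<close> when bidding \<open>b\<close>. Monotonicity
  compares the two, whichever of \<open>b\<close> and \<open>c\<close> is larger.\<close>

lemma truthful_utility_le:
  assumes "truthful \<gamma>" "0 \<le> b" "0 \<le> c"
  shows "c * alloc \<gamma> b - pay \<gamma> b \<le> c * alloc \<gamma> c - pay \<gamma> c"
proof -
  let ?x = "alloc \<gamma>"
  have mono: "mono_on {0..} ?x"
    and pay: "\<And>b. 0 \<le> b \<Longrightarrow> pay \<gamma> b = b * ?x b - integral {0..b} ?x"
    using assms(1) unfolding truthful_def by blast+
  have mono': "mono_on {a..d} ?x" if "0 \<le> a" for a d
    using mono by (rule mono_on_subset) (use that in auto)
  have split: "integral {0..a} ?x + integral {a..d} ?x = integral {0..d} ?x"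
    if "0 \<le> a" "a \<le> d" for a d
    by (rule Henstock_Kurzweil_Integration.integral_combine)
      (use that mono'[of 0 d] in \<open>auto intro: integrable_on_mono_on\<close>)
  show ?thesis
  proof (cases "b \<le> c")
    case True
    then show ?thesis
      using split[of b c] integral_mono_on_bounds(1)[OF mono'[of b c]] pay[of b] pay[of c] assms
      by (simp add: algebra_simps)
  next
    case False
    then show ?thesis
      using split[of c b] integral_mono_on_bounds(2)[OF mono'[of c b]] pay[of b] pay[of c] assms
      by (simp add: algebra_simps)
  qed
qed

text \<open>A bidder of value \<open>b\<close> does not gain by deviating to bid 0, so
  \<open>pay \<gamma> b \<le> b * alloc \<gamma> b\<close>. Hence the net gain is at least
  \<open>(v - b) x(b)\<close>, where \<open>x(b)\<close> lies in the unit interval.\<close>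

lemma net_gain_ge:
  assumes "truthful \<gamma>" "0 \<le> b"
  shows "net_gain \<gamma> b \<ge> min 0 (val \<gamma> - b)"
proof -
  let ?x = "alloc \<gamma>"
  have "b * ?x b - pay \<gamma> b \<ge> 0"
    using truthful_utility_le[OF assms(1) order_refl assms(2)] truthful_pay_zero[OF assms(1)]
      truthful_bounds(3)[OF assms(1) order_refl] assms(2)
    by (smt (verit) mult_nonneg_nonneg)
  then have "net_gain \<gamma> b \<ge> (val \<gamma> - b) * ?x b"
    by (simp add: net_gain_def algebra_simps)
  moreover have "(val \<gamma> - b) * ?x b \<ge> min 0 (val \<gamma> - b)"
  proof (cases "b \<le> val \<gamma>")
    case True
    then have "(val \<gamma> - b) * ?x b \<ge> 0"
      using truthful_bounds[OF assms] by simp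
    then show ?thesis by simp
  next
    case False
    then have "(b - val \<gamma>) * ?x b \<le> (b - val \<gamma>) * 1"
      using truthful_bounds[OF assms] by (intro mult_left_mono) auto
    then show ?thesis by (simp add: algebra_simps)
  qed
  ultimately show ?thesis by linarith
qed

lemma abs_net_gain_le:
  assumes "truthful \<gamma>" "0 \<le> b"
  shows "\<bar>net_gain \<gamma> b\<bar> \<le> 1"
  using truthful_bounds[OF assms] unfolding net_gain_def by linarith

lemma dual_bid_nonneg:
  assumes "0 \<le> v" "0 \<le> l" "0 \<le> m"
  shows "0 \<le> dual_bid l m v"
  using assms by (simp add: dual_bid_def)

text \<open>The dual bid exceeds the value by \<open>v (1 - m) / (m + l)\<close>, which is at most
  \<open>1 / l\<close>; overbidding by that much loses at most \<open>1 / l\<close>. A large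
  multiplier thus enforces near-satisfaction of RoS in each round, which later limits its own
  growth.\<close>

lemma net_gain_dual_bid_ge:
  assumes "truthful \<gamma>" "0 < l" "0 \<le> m"
  shows "l * net_gain \<gamma> (dual_bid l m (val \<gamma>)) \<ge> - 1"
proof -
  let ?v = "val \<gamma>"
  have v: "0 \<le> ?v" "?v \<le> 1"
    using truthful_bounds[OF assms(1) order_refl] by auto
  have "dual_bid l m ?v - ?v = ?v * ((1 - m) / (m + l))"
    using assms by (simp add: dual_bid_def field_simps)
  also have "\<dots> \<le> ?v * (1 / l)"
    using v assms by (intro mult_left_mono frac_le) auto
  also have "\<dots> \<le> 1 * (1 / l)"
    using v assms by (intro mult_right_mono) auto
  finally have "dual_bid l m ?v - ?v \<le> 1 / l" by simp
  then have "min 0 (?v - dual_bid l m ?v) \<ge> - (1 / l)"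
    using assms(2) by simp
  then have "net_gain \<gamma> (dual_bid l m ?v) \<ge> - (1 / l)"
    using net_gain_ge[OF assms(1) dual_bid_nonneg[of ?v l m]] v assms by linarith
  then have "l * net_gain \<gamma> (dual_bid l m ?v) \<ge> l * - (1 / l)"
    using assms(2) by (intro mult_left_mono) auto
  then show ?thesis using assms(2) by simp
qed

text \<open>With \<open>c\<close> the dual bid, the Lagrangian is
  \<open>(l + m) (c x - p) + m \<rho>\<close>, an increasing affine function of the utility of a
  bidder with true value \<open>c\<close>. Bidding \<open>c\<close> is optimal for that
  bidder.\<close>

lemma lagrangian_le_dual_bid:
  assumes "truthful \<gamma>" "0 < l" "0 \<le> m" "0 \<le> b"
  shows "lagrangian \<rho> l m \<gamma> b \<le> lagrangian \<rho> l m \<gamma> (dual_bid l m (val \<gamma>))"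
proof -
  let ?c = "dual_bid l m (val \<gamma>)"
  have c: "(l + m) * ?c = (1 + l) * val \<gamma>"
    using assms by (simp add: dual_bid_def add.commute)
  have eq: "lagrangian \<rho> l m \<gamma> a = (l + m) * (?c * alloc \<gamma> a - pay \<gamma> a) + m * \<rho>" for a
    using c by (simp add: lagrangian_def algebra_simps)
  have "0 \<le> ?c"
    using truthful_bounds[OF assms(1) order_refl] assms by (intro dual_bid_nonneg) auto
  then have "?c * alloc \<gamma> b - pay \<gamma> b \<le> ?c * alloc \<gamma> ?c - pay \<gamma> ?c"
    using assms by (intro truthful_utility_le) auto
  then show ?thesis
    unfolding eq using assms by (intro add_right_mono mult_left_mono) auto
qed

text \<open>Zero bids pay nothing. They witness that the supremum defining the hindsight optimum is
  over a nonempty set.\<close>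

lemma feasible_zero_bids:
  assumes "\<And>t. t < T \<Longrightarrow> truthful (\<gamma> t)" "0 \<le> \<rho>"
  shows "feasible \<rho> T \<gamma> (\<lambda>_. 0)" "0 \<le> total_value T \<gamma> (\<lambda>_. 0)"
proof -
  show "0 \<le> total_value T \<gamma> (\<lambda>_. 0)"
    unfolding total_value_def using assms by (intro sum_nonneg truthful_bounds(7)) auto
  moreover have "total_payment T \<gamma> (\<lambda>_. 0) = 0"
    unfolding total_payment_def using assms by (intro sum.neutral) (auto simp: truthful_pay_zero)
  ultimately show "feasible \<rho> T \<gamma> (\<lambda>_. 0)"
    using assms(2) by (simp add: feasible_def)
qed

text \<open>Weak duality: for feasible bids both slack terms are nonnegative, so the reward is at
  most the sum of the Lagrangians, which is then maximized round by round.\<close>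

lemma reward_opt_le_dual:
  assumes "\<And>t. t < T \<Longrightarrow> truthful (\<gamma> t)" "0 < l" "0 \<le> m" "0 \<le> \<rho>"
  shows "reward_opt \<rho> T \<gamma> \<le> (\<Sum>t<T. lagrangian \<rho> l m (\<gamma> t) (dual_bid l m (val (\<gamma> t))))"
  unfolding reward_opt_def
proof (rule cSup_least)
  have "feasible \<rho> T \<gamma> (\<lambda>_. 0)"
    by (rule feasible_zero_bids(1)) (use assms in auto)
  then show "{total_value T \<gamma> b |b. feasible \<rho> T \<gamma> b} \<noteq> {}"
    by blast
next
  fix r assume "r \<in> {total_value T \<gamma> b |b. feasible \<rho> T \<gamma> b}"
  then obtain b where r: "r = total_value T \<gamma> b" and b: "feasible \<rho> T \<gamma> b"
    by blast
  have "0 \<le> l * (total_value T \<gamma> b - total_payment T \<gamma> b)"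
    "0 \<le> m * (\<rho> * real T - total_payment T \<gamma> b)"
    using b assms(2,3) unfolding feasible_def by (intro mult_nonneg_nonneg; simp)+
  moreover have "(\<Sum>t<T. lagrangian \<rho> l m (\<gamma> t) (b t)) =
      (1 + l) * total_value T \<gamma> b - (l + m) * total_payment T \<gamma> b + m * \<rho> * real T"
    by (simp add: lagrangian_def total_value_def total_payment_def sum.distrib sum_subtractf
        sum_distrib_left)
  ultimately have "r \<le> (\<Sum>t<T. lagrangian \<rho> l m (\<gamma> t) (b t))"
    unfolding r by (simp add: algebra_simps)
  also have "\<dots> \<le> (\<Sum>t<T. lagrangian \<rho> l m (\<gamma> t) (dual_bid l m (val (\<gamma> t))))"
  proof (rule sum_mono)
    fix t assume "t \<in> {..<T}"
    then show "lagrangian \<rho> l m (\<gamma> t) (b t) \<le> lagrangian \<rho> l m (\<gamma> t) (dual_bid l m (val (\<gamma> t)))"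
      using assms(1)[of t] b lagrangian_le_dual_bid[of "\<gamma> t" l m "b t"] assms(2,3)
      by (simp add: feasible_def)
  qed
  finally show "r \<le> \<dots>" .
qed

text \<open>Needed to bound the regret from below, so that the infimum in
  \<open>upper_expectation\<close> is over a set bounded below. The bound \<open>T\<close> on all
  rewards makes the supremum a genuine one.\<close>

lemma reward_opt_nonneg:
  assumes "\<And>t. t < T \<Longrightarrow> truthful (\<gamma> t)" "0 \<le> \<rho>"
  shows "0 \<le> reward_opt \<rho> T \<gamma>"
proof -
  let ?S = "{total_value T \<gamma> b |b. feasible \<rho> T \<gamma> b}"
  have "feasible \<rho> T \<gamma> (\<lambda>_. 0)"
    by (rule feasible_zero_bids(1)) (use assms in auto)
  then have "total_value T \<gamma> (\<lambda>_. 0) \<in> ?S"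
    by blast
  moreover have "bdd_above ?S"
  proof (rule bdd_aboveI[where M = "real T"])
    fix r assume "r \<in> ?S"
    then obtain b where r: "r = total_value T \<gamma> b" and b: "feasible \<rho> T \<gamma> b"
      by blast
    have "r \<le> (\<Sum>t<T. 1)"
      unfolding r total_value_def
    proof (rule sum_mono)
      fix t assume "t \<in> {..<T}"
      then show "val (\<gamma> t) * alloc (\<gamma> t) (b t) \<le> 1"
        using assms(1)[of t] b truthful_bounds(8)[of "\<gamma> t" "b t"] by (simp add: feasible_def)
    qed
    then show "r \<le> real T" by simp
  qed
  ultimately have "total_value T \<gamma> (\<lambda>_. 0) \<le> reward_opt \<rho> T \<gamma>"
    unfolding reward_opt_def by (rule cSup_upper)
  moreover have "0 \<le> total_value T \<gamma> (\<lambda>_. 0)"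
    by (rule feasible_zero_bids(2)) (use assms in auto)
  ultimately show ?thesis by simp
qed

text \<open>The lower bound compares with bid 0, the upper one drops the payment. They give
  integrability and a finite infimum of the expected dual values.\<close>

lemma dual_value_bounds:
  assumes "truthful \<gamma>" "0 < l" "0 \<le> m" "0 \<le> \<rho>"
  shows "0 \<le> dual_value \<rho> l m \<gamma>" "dual_value \<rho> l m \<gamma> \<le> 1 + l + m * \<rho>"
proof -
  have "lagrangian \<rho> l m \<gamma> 0 \<ge> 0"
    using assms truthful_pay_zero[OF assms(1)] truthful_bounds(7)[OF assms(1) order_refl]
    unfolding lagrangian_def by (intro add_nonneg_nonneg mult_nonneg_nonneg) auto
  then show "0 \<le> dual_value \<rho> l m \<gamma>"
    unfolding dual_value_def using lagrangian_le_dual_bid[OF assms(1-3) order_refl] by (rule order_trans)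
  let ?b = "dual_bid l m (val \<gamma>)"
  have b: "0 \<le> ?b"
    using assms truthful_bounds(1)[OF assms(1) order_refl] by (intro dual_bid_nonneg) auto
  have "(1 + l) * (val \<gamma> * alloc \<gamma> ?b) \<le> (1 + l) * 1"
    using truthful_bounds(8)[OF assms(1) b] assms by (intro mult_left_mono) auto
  moreover have "0 \<le> (l + m) * pay \<gamma> ?b"
    using truthful_bounds(5)[OF assms(1) b] assms by (intro mult_nonneg_nonneg) auto
  ultimately show "dual_value \<rho> l m \<gamma> \<le> 1 + l + m * \<rho>"
    unfolding dual_value_def lagrangian_def by simp
qed


section \<open>Online learning bounds\<close>

text \<open>For positive \<open>y\<close>, combine \<open>1 + y \<le> exp y\<close> with
  \<open>(1 - y + y^2) (1 + y) = 1 + y^3\<close>. For the other sign it is the usual quadratic bound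
  on \<open>exp\<close> over the unit interval.\<close>

lemma exp_minus_le_quadratic:
  fixes y :: real
  assumes "\<bar>y\<bar> \<le> 1"
  shows "exp (- y) \<le> 1 - y + y\<^sup>2"
proof (cases "y \<le> 0")
  case True
  then show ?thesis using exp_bound[of "- y"] assms by simp
next
  case False
  have "1 \<le> (1 - y + y\<^sup>2) * (1 + y)"
  proof -
    have "(1 - y + y\<^sup>2) * (1 + y) = 1 + y ^ 3"
      by (simp add: algebra_simps power2_eq_square power3_eq_cube)
    then show ?thesis using False by simp
  qed
  also have "\<dots> \<le> (1 - y + y\<^sup>2) * exp y"
  proof (rule mult_left_mono)
    show "0 \<le> 1 - y + y\<^sup>2"
      using assms by (simp add: abs_if split: if_splits)
  qed simp
  finally show ?thesis
    by (simp add: exp_minus field_simps)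
qed

text \<open>The second-order term \<open>a^2 l g^2\<close> is bounded by
  \<open>a^2 (l g + 2)\<close>; its part \<open>a^2 l g\<close> merges with the linear term into the
  factor \<open>a (1 - a)\<close>.\<close>

lemma multiplicative_weight_step:
  fixes l g a :: real
  assumes "0 \<le> l" "\<bar>g\<bar> \<le> 1" "- 1 \<le> l * g" "0 \<le> a" "a \<le> 1"
  shows "l * exp (- a * g) \<le> l - a * (1 - a) * (l * g) + 2 * a\<^sup>2"
proof -
  have "\<bar>a * g\<bar> \<le> 1"
    using assms by (simp add: abs_mult mult_le_one)
  then have "l * exp (- a * g) \<le> l * (1 - a * g + (a * g)\<^sup>2)"
    using exp_minus_le_quadratic[of "a * g"] assms by (intro mult_left_mono) auto
  \<comment> \<open>The bound \<open>l * g \<ge> -1\<close> keeps the second-order term under control although \<open>l\<close> is unbounded.\<close>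
  moreover have "l * g\<^sup>2 \<le> l * g + 2"
  proof (cases "g \<ge> 0")
    case True
    then have "l * g * g \<le> l * g * 1"
      using assms by (intro mult_left_mono) auto
    then show ?thesis by (simp add: power2_eq_square algebra_simps)
  next
    case False
    then have "(- l * g) * (- g) \<le> (- l * g) * 1"
      using assms by (intro mult_left_mono mult_nonneg_nonpos) (auto simp: mult_nonneg_nonpos)
    then show ?thesis using assms by (simp add: power2_eq_square algebra_simps)
  qed
  then have "a\<^sup>2 * (l * g\<^sup>2) \<le> a\<^sup>2 * (l * g + 2)"
    by (intro mult_left_mono) auto
  ultimately show ?thesis
    by (simp add: algebra_simps power2_eq_square)
qed

text \<open>The weight is its own potential: telescoping the one-step bound gives the regret against
  comparator 0. Inserting \<open>l g \<ge> -1\<close> instead gives growth by at most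
  \<open>a + a^2 \<le> 2 a\<close> per round, hence linear and not exponential growth.\<close>

lemma multiplicative_weight_sum:
  fixes l g :: "nat \<Rightarrow> real"
  assumes "l 0 = 1" "\<And>t. t < n \<Longrightarrow> l (Suc t) = l t * exp (- a * g t)"
    "\<And>t. t < n \<Longrightarrow> \<bar>g t\<bar> \<le> 1" "\<And>t. t < n \<Longrightarrow> - 1 \<le> l t * g t"
    "\<And>t. 0 \<le> l t" "0 \<le> a" "a \<le> 1"
  shows "l n + a * (1 - a) * (\<Sum>t<n. l t * g t) \<le> 1 + 2 * a\<^sup>2 * real n"
    and "l n \<le> 1 + 2 * a * real n"
proof -
  have step: "l (Suc t) \<le> l t - a * (1 - a) * (l t * g t) + 2 * a\<^sup>2" if "t < n" for t
    using multiplicative_weight_step[of "l t" "g t" a] assms that by simp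
  have step': "l (Suc t) \<le> l t + 2 * a" if "t < n" for t
  proof -
    have "a * (1 - a) * - 1 \<le> a * (1 - a) * (l t * g t)"
      using assms that by (intro mult_left_mono) auto
    moreover have "a * a \<le> a * 1"
      using assms by (intro mult_left_mono) auto
    ultimately show ?thesis
      using step[OF that] by (simp add: algebra_simps power2_eq_square)
  qed
  have "k \<le> n \<Longrightarrow> l k + a * (1 - a) * (\<Sum>t<k. l t * g t) \<le> 1 + 2 * a\<^sup>2 * real k" for k
  proof (induction k)
    case (Suc k)
    then show ?case using step[of k] by (simp add: algebra_simps)
  qed (simp add: assms)
  then show "l n + a * (1 - a) * (\<Sum>t<n. l t * g t) \<le> 1 + 2 * a\<^sup>2 * real n"
    by simp
  have "k \<le> n \<Longrightarrow> l k \<le> 1 + 2 * a * real k" for k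
  proof (induction k)
    case (Suc k)
    then show ?case using step'[of k] by (simp add: algebra_simps)
  qed (simp add: assms)
  then show "l n \<le> 1 + 2 * a * real n"
    by simp
qed

text \<open>Standard analysis with the squared distance to the comparator \<open>u\<close> as
  potential.\<close>

lemma projected_gradient_sum:
  fixes m q :: "nat \<Rightarrow> real"
  assumes "m 0 = 0" "\<And>t. t < n \<Longrightarrow> m (Suc t) = max 0 (m t - e * q t)"
    "\<And>t. t < n \<Longrightarrow> (q t)\<^sup>2 \<le> G" "0 < e" "0 \<le> u"
  shows "(\<Sum>t<n. q t * (m t - u)) \<le> u\<^sup>2 / (2 * e) + e * G * real n / 2"
proof -
  have step: "(m (Suc t) - u)\<^sup>2 \<le> (m t - u)\<^sup>2 - 2 * e * (q t * (m t - u)) + e\<^sup>2 * G" if "t < n" for t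
  proof -
    \<comment> \<open>Projecting to the nonnegative half-line cannot increase the distance to
      \<open>u\<close>, which lies in it.\<close>
    have "(m (Suc t) - u)\<^sup>2 \<le> (m t - e * q t - u)\<^sup>2"
      using assms(2)[OF that] assms(5) by (auto simp: max_def abs_le_square_iff[symmetric])
    also have "\<dots> = (m t - u)\<^sup>2 - 2 * e * (q t * (m t - u)) + e\<^sup>2 * (q t)\<^sup>2"
      by (simp add: power2_eq_square algebra_simps)
    also have "\<dots> \<le> (m t - u)\<^sup>2 - 2 * e * (q t * (m t - u)) + e\<^sup>2 * G"
      using assms(3)[OF that] by (intro add_left_mono mult_left_mono) auto
    finally show ?thesis .
  qed
  have "k \<le> n \<Longrightarrow> (m k - u)\<^sup>2 + 2 * e * (\<Sum>t<k. q t * (m t - u)) \<le> u\<^sup>2 + e\<^sup>2 * G * real k" for k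
  proof (induction k)
    case (Suc k)
    then show ?case using step[of k] by (simp add: algebra_simps)
  qed (simp add: assms)
  from this[of n] have "2 * e * (\<Sum>t<n. q t * (m t - u)) \<le> u\<^sup>2 + e\<^sup>2 * G * real n"
    using zero_le_power2[of "m n - u"] by linarith
  then show ?thesis
    using assms(4) by (simp add: field_simps power2_eq_square)
qed


section \<open>A run on a fixed request sequence\<close>

definition ros_dual :: "real \<Rightarrow> nat \<Rightarrow> (nat \<Rightarrow> request) \<Rightarrow> nat \<Rightarrow> real" where
  "ros_dual \<rho> T \<gamma> t = fst (state \<rho> T \<gamma> t)"

definition budget_dual :: "real \<Rightarrow> nat \<Rightarrow> (nat \<Rightarrow> request) \<Rightarrow> nat \<Rightarrow> real" where
  "budget_dual \<rho> T \<gamma> t = fst (snd (state \<rho> T \<gamma> t))"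

definition budget_left :: "real \<Rightarrow> nat \<Rightarrow> (nat \<Rightarrow> request) \<Rightarrow> nat \<Rightarrow> real" where
  "budget_left \<rho> T \<gamma> t = snd (snd (state \<rho> T \<gamma> t))"

lemma state_eq: "state \<rho> T \<gamma> t = (ros_dual \<rho> T \<gamma> t, budget_dual \<rho> T \<gamma> t, budget_left \<rho> T \<gamma> t)"
  by (simp add: ros_dual_def budget_dual_def budget_left_def)

lemma algorithm_A_eq:
  "algorithm_A \<rho> T \<gamma> t =
     (if budget_left \<rho> T \<gamma> t \<ge> 1
      then dual_bid (ros_dual \<rho> T \<gamma> t) (budget_dual \<rho> T \<gamma> t) (val (\<gamma> t)) else 0)"
  by (simp add: algorithm_A_def state_eq dual_bid_def)

lemma initial_state:
  "ros_dual \<rho> T \<gamma> 0 = 1" "budget_dual \<rho> T \<gamma> 0 = 0" "budget_left \<rho> T \<gamma> 0 = \<rho> * real T"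
  by (simp_all add: ros_dual_def budget_dual_def budget_left_def)

lemma next_state:
  "ros_dual \<rho> T \<gamma> (Suc t) =
     ros_dual \<rho> T \<gamma> t * exp (- (1 / sqrt (real T)) * net_gain (\<gamma> t) (algorithm_A \<rho> T \<gamma> t))"
  "budget_dual \<rho> T \<gamma> (Suc t) =
     max 0 (budget_dual \<rho> T \<gamma> t
       - 1 / ((1 + \<rho>\<^sup>2) * sqrt (real T)) * (\<rho> - pay (\<gamma> t) (algorithm_A \<rho> T \<gamma> t)))"
  "budget_left \<rho> T \<gamma> (Suc t) = budget_left \<rho> T \<gamma> t - pay (\<gamma> t) (algorithm_A \<rho> T \<gamma> t)"
proof -
  have "state \<rho> T \<gamma> (Suc t) =
    (ros_dual \<rho> T \<gamma> t * exp (- (1 / sqrt (real T)) * net_gain (\<gamma> t) (algorithm_A \<rho> T \<gamma> t)),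
     max 0 (budget_dual \<rho> T \<gamma> t
       - 1 / ((1 + \<rho>\<^sup>2) * sqrt (real T)) * (\<rho> - pay (\<gamma> t) (algorithm_A \<rho> T \<gamma> t))),
     budget_left \<rho> T \<gamma> t - pay (\<gamma> t) (algorithm_A \<rho> T \<gamma> t))"
    unfolding algorithm_A_def state.simps(2) state_eq[of \<rho> T \<gamma> t] update.simps Let_def ..
  then show "ros_dual \<rho> T \<gamma> (Suc t) =
     ros_dual \<rho> T \<gamma> t * exp (- (1 / sqrt (real T)) * net_gain (\<gamma> t) (algorithm_A \<rho> T \<gamma> t))"
  "budget_dual \<rho> T \<gamma> (Suc t) =
     max 0 (budget_dual \<rho> T \<gamma> t
       - 1 / ((1 + \<rho>\<^sup>2) * sqrt (real T)) * (\<rho> - pay (\<gamma> t) (algorithm_A \<rho> T \<gamma> t)))"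
  "budget_left \<rho> T \<gamma> (Suc t) = budget_left \<rho> T \<gamma> t - pay (\<gamma> t) (algorithm_A \<rho> T \<gamma> t)"
    unfolding state_eq[of \<rho> T \<gamma> "Suc t"] by blast+
qed

lemma ros_dual_pos: "0 < ros_dual \<rho> T \<gamma> t"
  by (induction t) (simp_all add: initial_state next_state)

lemma budget_dual_nonneg: "0 \<le> budget_dual \<rho> T \<gamma> t"
  by (cases t) (simp_all add: initial_state next_state)

text \<open>Source of the independence between the multipliers of a round and its request.\<close>

lemma state_cong:
  "(\<And>s. s < t \<Longrightarrow> \<gamma> s = \<gamma>' s) \<Longrightarrow> state \<rho> T \<gamma> t = state \<rho> T \<gamma>' t"
  by (induction t) simp_all

lemma algorithm_A_nonneg:
  assumes "truthful (\<gamma> t)"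
  shows "0 \<le> algorithm_A \<rho> T \<gamma> t"
  using dual_bid_nonneg[of "val (\<gamma> t)"] truthful_bounds(1)[OF assms order_refl]
    ros_dual_pos[of \<rho> T \<gamma> t] budget_dual_nonneg[of \<rho> T \<gamma> t]
  by (simp add: algorithm_A_eq)

locale bidding_run =
  fixes \<rho> :: real and T :: nat and \<gamma> :: "nat \<Rightarrow> request"
  assumes rho: "0 < \<rho>" and horizon: "2 \<le> T" and truthful: "\<And>t. t < T \<Longrightarrow> truthful (\<gamma> t)"
begin

abbreviation "l \<equiv> ros_dual \<rho> T \<gamma>"
abbreviation "m \<equiv> budget_dual \<rho> T \<gamma>"
abbreviation "B \<equiv> budget_left \<rho> T \<gamma>"
abbreviation "a \<equiv> algorithm_A \<rho> T \<gamma>"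
abbreviation "x t \<equiv> alloc (\<gamma> t) (a t)"
abbreviation "p t \<equiv> pay (\<gamma> t) (a t)"
abbreviation "g t \<equiv> net_gain (\<gamma> t) (a t)"

lemma bounds:
  assumes "t < T"
  shows "0 \<le> p t" "p t \<le> 1" "0 \<le> val (\<gamma> t) * x t" "\<bar>g t\<bar> \<le> 1"
proof -
  have "0 \<le> a t"
    by (rule algorithm_A_nonneg) (rule truthful[OF assms])
  note t = truthful[OF assms] this
  show "0 \<le> p t" "p t \<le> 1" "0 \<le> val (\<gamma> t) * x t" "\<bar>g t\<bar> \<le> 1"
    by (rule truthful_bounds(5)[OF t] truthful_bounds(6)[OF t] truthful_bounds(7)[OF t]
        abs_net_gain_le[OF t])+
qed

text \<open>The bid is then 0, which is free but may still win an item; so skipped rounds never hurt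
  either constraint.\<close>

lemma inactive:
  assumes "t < T" "B t < 1"
  shows "p t = 0" "0 \<le> g t"
  using assms truthful_pay_zero[OF truthful[OF assms(1)]] bounds(3)[OF assms(1)]
  by (simp_all add: algorithm_A_eq net_gain_def)

lemma ros_dual_mult_net_gain_ge:
  assumes "t < T"
  shows "- 1 \<le> l t * g t"
proof (cases "B t < 1")
  case True
  then show ?thesis
    using inactive(2)[OF assms True] ros_dual_pos[of \<rho> T \<gamma> t] mult_nonneg_nonneg[of "l t" "g t"]
    by linarith
next
  case False
  then show ?thesis
    using net_gain_dual_bid_ge[OF truthful[OF assms] ros_dual_pos budget_dual_nonneg]
    by (simp add: algorithm_A_eq)
qed

section \<open>The budget constraint\<close>

lemma budget_left_eq: "B t = \<rho> * real T - (\<Sum>s<t. p s)"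
  by (induction t) (simp_all add: initial_state next_state)

text \<open>A positive payment occurs only with at least 1 left, and it is at most 1.\<close>

lemma budget_left_nonneg: "t \<le> T \<Longrightarrow> 0 \<le> B t"
proof (induction t)
  case 0
  then show ?case using rho by (simp add: initial_state)
next
  case (Suc t)
  then show ?case
    using inactive(1)[of t] bounds(2)[of t] by (cases "B t < 1") (auto simp: next_state)
qed

lemma total_payment_le_budget: "total_payment T \<gamma> a \<le> \<rho> * real T"
  using budget_left_eq[of T] budget_left_nonneg[of T] by (simp add: total_payment_def)

section \<open>Growth of the RoS multiplier and the RoS violation\<close>

lemma sqrt_horizon: "4 / 3 \<le> sqrt (real T)"
  by (rule real_le_rsqrt) (use horizon in \<open>simp add: power2_eq_square\<close>)

lemma ros_dual_le: "l T \<le> 1 + 2 * sqrt (real T)"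
  and sum_ros_dual_mult_net_gain: "(\<Sum>t<T. l t * g t) \<le> 12 * sqrt (real T)"
proof -
  let ?a = "1 / sqrt (real T)"
  have a: "0 < ?a" "?a \<le> 3 / 4" and T: "?a * real T = sqrt (real T)" "?a\<^sup>2 * real T = 1"
    using horizon sqrt_horizon by (simp_all add: divide_le_eq real_div_sqrt power_divide)
  note weights = multiplicative_weight_sum[of l T ?a g, OF initial_state(1) next_state(1)
      bounds(4) ros_dual_mult_net_gain_ge less_imp_le[OF ros_dual_pos]]
  show "l T \<le> 1 + 2 * sqrt (real T)"
    using weights(2) a T(1) by simp
  let ?S = "\<Sum>t<T. l t * g t"
  have "?a * (1 - ?a) * ?S \<le> 3"
    using weights(1) a T(2) ros_dual_pos[of \<rho> T \<gamma> T] by simp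
  show "?S \<le> 12 * sqrt (real T)"
  proof (cases "?S \<le> 0")
    case True
    then show ?thesis using sqrt_horizon by linarith
  next
    case False
    \<comment> \<open>\<open>T \<ge> 2\<close> gives \<open>sqrt T \<ge> 4 / 3\<close>, hence
      \<open>1 - ?a \<ge> 1 / 4\<close>. Replacing the factor is sound because \<open>?S\<close> is
      positive in this case.\<close>
    then have "?a * (1 / 4) * ?S \<le> ?a * (1 - ?a) * ?S"
      using a by (intro mult_right_mono mult_left_mono) auto
    then have "?a * (1 / 4) * ?S \<le> 3"
      using \<open>?a * (1 - ?a) * ?S \<le> 3\<close> by (rule order_trans)
    then show ?thesis
      using horizon by (simp add: divide_le_eq)
  qed
qed

text \<open>Unfolding the update, \<open>ln (l T)\<close> is the RoS violation divided by
  \<open>sqrt T\<close>, and \<open>l T\<close> is only of order \<open>sqrt T\<close>.\<close>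

lemma ros_violation_le:
  "total_payment T \<gamma> a - total_value T \<gamma> a \<le> 5 / 2 * sqrt (real T) * ln (real T)"
proof -
  have "l t = exp (- (1 / sqrt (real T)) * (\<Sum>s<t. g s))" for t
    by (induction t) (simp_all add: initial_state next_state ring_distribs flip: exp_add)
  then have "ln (l T) = - (1 / sqrt (real T)) * (\<Sum>t<T. g t)"
    by simp
  also have "\<dots> = (1 / sqrt (real T)) * (total_payment T \<gamma> a - total_value T \<gamma> a)"
    by (simp add: net_gain_def total_payment_def total_value_def sum_subtractf algebra_simps)
  finally have "total_payment T \<gamma> a - total_value T \<gamma> a = sqrt (real T) * ln (l T)"
    using horizon by simp
  also have "ln (l T) \<le> ln ((real T)\<^sup>2 * sqrt (real T))"
  proof -
    have "l T \<le> 3 * sqrt (real T)"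
      using ros_dual_le sqrt_horizon by linarith
    \<comment> \<open>The constant 3 is absorbed by \<open>T^2 \<ge> 4\<close>, so that the
      logarithm becomes a pure multiple of \<open>ln T\<close>.\<close>
    also have "\<dots> \<le> (real T)\<^sup>2 * sqrt (real T)"
      using horizon power_mono[of 2 "real T" 2] by (intro mult_right_mono) auto
    finally show ?thesis
      using ros_dual_pos[of \<rho> T \<gamma> T] by (intro ln_mono) auto
  qed
  also have "ln ((real T)\<^sup>2 * sqrt (real T)) = 5 / 2 * ln (real T)"
    using horizon by (simp add: ln_mult ln_sqrt ln_realpow)
  finally show ?thesis
    using sqrt_horizon by (simp add: mult_left_mono mult.assoc mult.left_commute)
qed

section \<open>Budget exhaustion and the collected value\<close>

lemma budget_exhaustion_time:
  obtains n where "n \<le> T" "\<And>t. t < n \<Longrightarrow> 1 \<le> B t" "\<And>t. n \<le> t \<Longrightarrow> t < T \<Longrightarrow> B t < 1"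
    "n < T \<Longrightarrow> (\<Sum>t<n. \<rho> - p t) \<le> 1 - \<rho> * (real T - real n)"
proof (cases "\<forall>t<T. 1 \<le> B t")
  case True
  then show ?thesis using that[of T] by auto
next
  case False
  \<comment> \<open>From the first round with less than 1 left the budget is frozen. The spending
    before it exceeds \<open>\<rho> T - 1\<close>, so the summed slack \<open>\<rho> - p t\<close>
    is strongly negative if many rounds remain.\<close>
  define n where "n = (LEAST t. t < T \<and> B t < 1)"
  have n: "n < T" "B n < 1"
    using LeastI_ex[of "\<lambda>t. t < T \<and> B t < 1"] False by (auto simp: n_def not_le)
  have "1 \<le> B t" if "t < n" for t
    using not_less_Least[of t "\<lambda>t. t < T \<and> B t < 1"] that n(1) by (auto simp: n_def)
  moreover have "t \<le> T \<Longrightarrow> B t < 1" if "n \<le> t" for t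
    using that
  proof (induction t rule: dec_induct)
    case base
    then show ?case using n by simp
  next
    case (step t)
    then show ?case using inactive(1)[of t] by (simp add: next_state)
  qed
  moreover have "(\<Sum>t<n. \<rho> - p t) \<le> 1 - \<rho> * (real T - real n)"
    using n(2) budget_left_eq[of n] by (simp add: sum_subtractf algebra_simps)
  ultimately show ?thesis
    using that[of n] n(1) by auto
qed

text \<open>In an active round the reward is the dual value minus \<open>l t * g t\<close> and
  \<open>(\<rho> - p t) * m t\<close>. Subtracting \<open>D\<close> inside the activity test leaves
  summands that can be averaged round by round, although the exhaustion time is random. The 13 is 12
  from the weights plus 1 from the gradient steps; the fraction comes from the squared comparator
  \<open>1 / \<rho>^2\<close>, and \<open>1 / \<rho>\<close> from the less than 1 of budget left
  over.\<close>

lemma total_value_ge: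
  assumes "D \<le> 1"
  shows "total_value T \<gamma> a \<ge>
    (\<Sum>t<T. if 1 \<le> B t then dual_value \<rho> (l t) (m t) (\<gamma> t) - D else 0) + real T * D
    - (13 + (1 + \<rho>\<^sup>2) / (2 * \<rho>\<^sup>2)) * sqrt (real T) - 1 / \<rho>"
proof -
  obtain n where n: "n \<le> T" "\<And>t. t < n \<Longrightarrow> 1 \<le> B t" "\<And>t. n \<le> t \<Longrightarrow> t < T \<Longrightarrow> B t < 1"
    "n < T \<Longrightarrow> (\<Sum>t<n. \<rho> - p t) \<le> 1 - \<rho> * (real T - real n)"
    using budget_exhaustion_time by blast
  define q where "q t = \<rho> - p t" for t
  let ?e = "1 / ((1 + \<rho>\<^sup>2) * sqrt (real T))"
  have active: "(\<Sum>t<T. if 1 \<le> B t then dual_value \<rho> (l t) (m t) (\<gamma> t) - D else 0) =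
      (\<Sum>t<n. dual_value \<rho> (l t) (m t) (\<gamma> t)) - real n * D"
  proof -
    have "(\<Sum>t<T. if 1 \<le> B t then dual_value \<rho> (l t) (m t) (\<gamma> t) - D else 0) =
      (\<Sum>t<n. if 1 \<le> B t then dual_value \<rho> (l t) (m t) (\<gamma> t) - D else 0)"
    proof (intro sum.mono_neutral_right ballI)
      fix t assume "t \<in> {..<T} - {..<n}"
      then have "B t < 1"
        using n(3)[of t] by simp
      then show "(if 1 \<le> B t then dual_value \<rho> (l t) (m t) (\<gamma> t) - D else 0) = 0"
        by simp
    qed (use n(1) in auto)
    also have "\<dots> = (\<Sum>t<n. dual_value \<rho> (l t) (m t) (\<gamma> t) - D)"
      using n(2) by (intro sum.cong) auto
    finally show ?thesis by (simp add: sum_subtractf)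
  qed
  have primal: "(\<Sum>t<n. val (\<gamma> t) * x t) =
      (\<Sum>t<n. dual_value \<rho> (l t) (m t) (\<gamma> t)) - (\<Sum>t<n. l t * g t) - (\<Sum>t<n. q t * m t)"
  proof -
    have "(\<Sum>t<n. val (\<gamma> t) * x t) =
      (\<Sum>t<n. dual_value \<rho> (l t) (m t) (\<gamma> t) - l t * g t - q t * m t)"
      using n(2) by (intro sum.cong)
        (auto simp: dual_value_def lagrangian_def algorithm_A_eq net_gain_def q_def algebra_simps)
    then show ?thesis by (simp add: sum_subtractf)
  qed
  have "(\<Sum>t<n. val (\<gamma> t) * x t) \<le> total_value T \<gamma> a"
    unfolding total_value_def using n(1) bounds(3) by (intro sum_mono2) auto
  moreover have "(\<Sum>t<n. l t * g t) \<le> 12 * sqrt (real T)"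
  proof -
    \<comment> \<open>Skipped rounds have nonnegative gain, so extending the sum to the full horizon
      can only increase it.\<close>
    have "(\<Sum>t<n. l t * g t) \<le> (\<Sum>t<T. l t * g t)"
      using n inactive(2) less_imp_le[OF ros_dual_pos]
      by (intro sum_mono2) (auto simp: not_less)
    then show ?thesis using sum_ros_dual_mult_net_gain by linarith
  qed
  moreover have "(\<Sum>t<n. q t * m t) + (real T - real n) * D \<le>
      (1 + (1 + \<rho>\<^sup>2) / (2 * \<rho>\<^sup>2)) * sqrt (real T) + 1 / \<rho>"
  proof -
    \<comment> \<open>If the budget runs out at time n, the comparator 1/\<rho> makes the gradient regret pay for the
      T - n skipped rounds, each worth at most 1.\<close>
    define u where "u = (if n < T then 1 / \<rho> else 0)"
    have u: "0 \<le> u" "u\<^sup>2 \<le> 1 / \<rho>\<^sup>2"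
      using rho by (auto simp: u_def power_divide)
    \<comment> \<open>The cross term is nonpositive. The factor \<open>1 + \<rho>^2\<close> in the
      step size is this bound and cancels below.\<close>
    have q2: "(q t)\<^sup>2 \<le> 1 + \<rho>\<^sup>2" if "t < n" for t
    proof -
      have "p t * p t \<le> 1" "0 \<le> \<rho> * p t"
        using bounds(1,2)[of t] that n(1) rho by (auto intro!: mult_le_one)
      then show ?thesis by (simp add: q_def power2_eq_square algebra_simps)
    qed
    have "(\<Sum>t<n. q t * (m t - u)) \<le> u\<^sup>2 / (2 * ?e) + ?e * (1 + \<rho>\<^sup>2) * real n / 2"
    proof (rule projected_gradient_sum)
      show "0 < ?e"
        using horizon by (intro divide_pos_pos mult_pos_pos add_pos_nonneg) auto
    qed (use u(1) q2 in \<open>auto simp: initial_state next_state q_def\<close>)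
    also have "?e * (1 + \<rho>\<^sup>2) * real n / 2 \<le> sqrt (real T)"
    proof -
      have "1 + \<rho>\<^sup>2 > 0"
        by (simp add: add_pos_nonneg)
      then have "?e * (1 + \<rho>\<^sup>2) = 1 / sqrt (real T)"
        by simp
      then have eq: "?e * (1 + \<rho>\<^sup>2) * real n = real n / sqrt (real T)"
        by (simp only: times_divide_eq_left mult_1_left)
      have "real n / sqrt (real T) \<le> real T / sqrt (real T)"
        using n(1) by (intro divide_right_mono) auto
      also have "\<dots> = sqrt (real T)"
        by (simp add: real_div_sqrt)
      finally have le: "real n / sqrt (real T) \<le> sqrt (real T)" .
      have half: "y / 2 \<le> z" if "y \<le> z" "0 \<le> z" for y z :: real
        using that by linarith
      show ?thesis
        unfolding eq by (rule half[OF le]) simp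
    qed
    also have "u\<^sup>2 / (2 * ?e) = u\<^sup>2 * ((1 + \<rho>\<^sup>2) / 2 * sqrt (real T))"
      by simp
    also have "\<dots> \<le> 1 / \<rho>\<^sup>2 * ((1 + \<rho>\<^sup>2) / 2 * sqrt (real T))"
      using u(2) by (rule mult_right_mono) simp
    also have "1 / \<rho>\<^sup>2 * ((1 + \<rho>\<^sup>2) / 2 * sqrt (real T)) + sqrt (real T) =
        (1 + (1 + \<rho>\<^sup>2) / (2 * \<rho>\<^sup>2)) * sqrt (real T)"
    proof -
      have "1 / r * (k / 2 * s) + s = (1 + k / (2 * r)) * s" for r k s :: real
        by (simp add: algebra_simps)
      then show ?thesis .
    qed
    finally have gradient: "(\<Sum>t<n. q t * (m t - u)) \<le>
        (1 + (1 + \<rho>\<^sup>2) / (2 * \<rho>\<^sup>2)) * sqrt (real T)"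
      by simp
    have "u * (\<Sum>t<n. q t) + (real T - real n) * D \<le> 1 / \<rho>"
    proof (cases "n < T")
      case True
      then have "1 / \<rho> * (\<Sum>t<n. q t) \<le> 1 / \<rho> * (1 - \<rho> * (real T - real n))"
        using n(4) rho by (intro mult_left_mono) (auto simp: q_def)
      also have "\<dots> = 1 / \<rho> - (real T - real n)"
        using rho by (simp add: field_simps)
      finally have "1 / \<rho> * (\<Sum>t<n. q t) \<le> 1 / \<rho> - (real T - real n)" .
      moreover have "(real T - real n) * D \<le> (real T - real n) * 1"
        using assms n(1) by (intro mult_left_mono) auto
      moreover have "u = 1 / \<rho>"
        using True by (simp add: u_def)
      ultimately show ?thesis by simp
    next
      case False
      then show ?thesis using n(1) rho by (simp add: u_def)
    qed
    with gradient show ?thesis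
      by (simp add: right_diff_distrib sum_subtractf sum_distrib_left mult.commute)
  qed
  ultimately show ?thesis
    unfolding active using primal by (simp add: algebra_simps)
qed

text \<open>Both step sizes are at most 1. These crude bounds serve only integrability.\<close>

lemma state_le:
  assumes "t \<le> T"
  shows "l t \<le> exp (real t)" "m t \<le> real t"
proof -
  have "l t \<le> exp (real t) \<and> m t \<le> real t"
    using assms
  proof (induction t)
    case 0
    then show ?case by (simp add: initial_state)
  next
    case (Suc t)
    note bnd = bounds[of t]
    have s: "1 \<le> sqrt (real T)"
      using sqrt_horizon by linarith
    have "- (1 / sqrt (real T)) * g t \<le> 1"
    proof -
      have "\<bar>1 / sqrt (real T) * g t\<bar> \<le> 1"
        unfolding abs_mult using bnd Suc s by (intro mult_le_one) auto
      then show ?thesis by linarith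
    qed
    then have "l t * exp (- (1 / sqrt (real T)) * g t) \<le> exp (real t) * exp 1"
      using Suc by (intro mult_mono) auto
    moreover have "m t - 1 / ((1 + \<rho>\<^sup>2) * sqrt (real T)) * (\<rho> - p t) \<le> real t + 1"
    proof -
      have "1 * 1 \<le> (1 + \<rho>\<^sup>2) * sqrt (real T)"
        using s by (intro mult_mono) auto
      then have "1 / ((1 + \<rho>\<^sup>2) * sqrt (real T)) \<le> 1"
        by (simp add: divide_le_eq)
      moreover have "0 \<le> 1 / ((1 + \<rho>\<^sup>2) * sqrt (real T))"
        by (simp add: add_nonneg_nonneg)
      ultimately have "1 / ((1 + \<rho>\<^sup>2) * sqrt (real T)) * (p t - \<rho>) \<le> 1"
        using bnd rho Suc
        by (intro order_trans[OF mult_left_mono[of "p t - \<rho>" 1]]) auto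
      then show ?thesis
        using Suc by (simp add: right_diff_distrib diff_divide_distrib)
    qed
    ultimately show ?case
      by (simp add: next_state exp_add[symmetric] add.commute)
  qed
  then show "l t \<le> exp (real t)" "m t \<le> real t" by auto
qed

end


section \<open>Random requests\<close>

text \<open>An infimum of reals lies below the elements of its set only if the set is bounded below;
  the almost sure lower bound \<open>c\<close> on \<open>f\<close> bounds the mean of every
  majorant.\<close>

lemma upper_expectation_le:
  assumes "prob_space M" "integrable M Z" "AE \<omega> in M. f \<omega> \<le> Z \<omega>" "AE \<omega> in M. c \<le> f \<omega>"
  shows "upper_expectation M f \<le> integral\<^sup>L M Z"
  unfolding upper_expectation_def
proof (rule cInf_lower)
  show "bdd_below {integral\<^sup>L M Z |Z. integrable M Z \<and> (AE \<omega> in M. f \<omega> \<le> Z \<omega>)}"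
  proof (rule bdd_belowI[where m = c])
    fix r assume "r \<in> {integral\<^sup>L M Z |Z. integrable M Z \<and> (AE \<omega> in M. f \<omega> \<le> Z \<omega>)}"
    then obtain W where W: "r = integral\<^sup>L M W" "integrable M W" "AE \<omega> in M. f \<omega> \<le> W \<omega>"
      by blast
    have "AE \<omega> in M. c \<le> W \<omega>"
      using W(3) assms(4) by eventually_elim simp
    then show "c \<le> r"
      unfolding W(1) using prob_space.integral_ge_const[OF assms(1) W(2)] by blast
  qed
qed (use assms in blast)

text \<open>Turns the payment integral into a Lebesgue integral over a fixed space, as measurability
  in a parameter requires. The \<open>max 0 z\<close> avoids negative arguments and makes the
  allocation monotone, hence Borel, on the whole line.\<close>

lemma integral_alloc_eq:
  assumes "truthful \<gamma>" "0 \<le> b"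
  shows "integral {0..b} (alloc \<gamma>) =
    (\<integral>z. (if 0 \<le> z \<and> z \<le> b then alloc \<gamma> (max 0 z) else 0) \<partial>lborel)"
proof -
  let ?x = "\<lambda>z. alloc \<gamma> (max 0 z)"
  have "mono_on {0..} (alloc \<gamma>)"
    using assms(1) unfolding truthful_def by blast
  then have "mono ?x"
    by (auto simp: mono_def mono_on_def)
  then have "?x \<in> borel_measurable borel"
    by (rule borel_measurable_mono)
  then have "set_integrable lborel {0..b} ?x"
    unfolding set_integrable_def using assms truthful_bounds(3,4)[OF assms(1)]
    by (intro integrableI_bounded_set_indicator[where B = 1]) auto
  then have "integral {0..b} ?x = (LINT z:{0..b}|lborel. ?x z)"
    by (simp add: set_borel_integral_eq_integral(2))
  also have "\<dots> = (\<integral>z. (if 0 \<le> z \<and> z \<le> b then ?x z else 0) \<partial>lborel)"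
    unfolding set_lebesgue_integral_def by (intro Bochner_Integration.integral_cong) auto
  also have "integral {0..b} ?x = integral {0..b} (alloc \<gamma>)"
    by (rule Henstock_Kurzweil_Integration.integral_cong) auto
  finally show ?thesis .
qed

locale iid_requests =
  fixes P :: "request measure" and \<rho> :: real and T :: nat
  assumes P: "request_distribution P" and rho: "0 < \<rho>" and horizon: "2 \<le> T"
begin

sublocale prob_space P
  using P by (simp add: request_distribution_def)

sublocale product: product_prob_space "\<lambda>_. P" "{..<T}"
  by standard

abbreviation "PT \<equiv> Pi\<^sub>M {..<T} (\<lambda>_. P)"

lemma truthful: "\<gamma> \<in> space P \<Longrightarrow> truthful \<gamma>"
  using P by (simp add: request_distribution_def)

lemma val_measurable [measurable]: "val \<in> borel_measurable P"
  using P by (simp add: request_distribution_def)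

section \<open>Measurability of auctions and of the run\<close>

lemma alloc_measurable:
  assumes f: "f \<in> measurable M P" and b: "b \<in> borel_measurable M" "\<And>\<omega>. \<omega> \<in> space M \<Longrightarrow> 0 \<le> b \<omega>"
  shows "(\<lambda>\<omega>. alloc (f \<omega>) (b \<omega>)) \<in> borel_measurable M"
proof -
  have "(\<lambda>(\<gamma>, b). alloc \<gamma> b) \<in> borel_measurable (P \<Otimes>\<^sub>M restrict_space borel {0..})"
    using P by (simp add: request_distribution_def)
  moreover have "b \<in> measurable M (restrict_space borel {0..})"
    using b by (intro measurable_restrict_space2) auto
  then have "(\<lambda>\<omega>. (f \<omega>, b \<omega>)) \<in> measurable M (P \<Otimes>\<^sub>M restrict_space borel {0..})"
    using f by simp
  ultimately show ?thesis
    by (auto dest: measurable_compose)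
qed

text \<open>The payment formula reduces this to the allocation and to an integral over
  \<open>z\<close> of a function jointly measurable in \<open>\<omega>\<close> and
  \<open>z\<close>.\<close>

lemma pay_measurable:
  assumes f: "f \<in> measurable M P" and b: "b \<in> borel_measurable M" "\<And>\<omega>. \<omega> \<in> space M \<Longrightarrow> 0 \<le> b \<omega>"
  shows "(\<lambda>\<omega>. pay (f \<omega>) (b \<omega>)) \<in> borel_measurable M"
proof -
  note [measurable] = f b(1)
  have [measurable]: "(\<lambda>\<omega>. alloc (f (fst \<omega>)) (max 0 (snd \<omega>))) \<in> borel_measurable (M \<Otimes>\<^sub>M lborel)"
    by (intro alloc_measurable) auto
  have "(\<lambda>\<omega>. \<integral>z. (if 0 \<le> z \<and> z \<le> b \<omega> then alloc (f \<omega>) (max 0 z) else 0) \<partial>lborel)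
      \<in> borel_measurable M"
  proof (rule lborel.borel_measurable_lebesgue_integral)
    have "(\<lambda>\<omega>. if 0 \<le> snd \<omega> \<and> snd \<omega> \<le> b (fst \<omega>) then alloc (f (fst \<omega>)) (max 0 (snd \<omega>)) else 0)
        \<in> borel_measurable (M \<Otimes>\<^sub>M lborel)"
      by measurable
    then show "(\<lambda>(\<omega>, z). if 0 \<le> z \<and> z \<le> b \<omega> then alloc (f \<omega>) (max 0 z) else 0)
        \<in> borel_measurable (M \<Otimes>\<^sub>M lborel)"
      by (simp add: case_prod_beta')
  qed
  moreover have "(\<lambda>\<omega>. alloc (f \<omega>) (b \<omega>)) \<in> borel_measurable M"
    by (intro alloc_measurable f b)
  ultimately have "(\<lambda>\<omega>. b \<omega> * alloc (f \<omega>) (b \<omega>) -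
      (\<integral>z. (if 0 \<le> z \<and> z \<le> b \<omega> then alloc (f \<omega>) (max 0 z) else 0) \<partial>lborel)) \<in> borel_measurable M"
    by measurable
  moreover have "pay (f \<omega>) (b \<omega>) = b \<omega> * alloc (f \<omega>) (b \<omega>) -
      (\<integral>z. (if 0 \<le> z \<and> z \<le> b \<omega> then alloc (f \<omega>) (max 0 z) else 0) \<partial>lborel)"
    if "\<omega> \<in> space M" for \<omega>
  proof -
    have t: "truthful (f \<omega>)"
      using measurable_space[OF f that] by (rule truthful)
    then have "pay (f \<omega>) (b \<omega>) = b \<omega> * alloc (f \<omega>) (b \<omega>) - integral {0..b \<omega>} (alloc (f \<omega>))"
      using b(2)[OF that] unfolding truthful_def by blast
    then show ?thesis
      using integral_alloc_eq[OF t b(2)[OF that]] by simp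
  qed
  ultimately show ?thesis
    by (simp cong: measurable_cong)
qed

text \<open>Stated for random multipliers, so as to cover constant ones as well as those of the
  run.\<close>

lemma dual_value_measurable:
  assumes f [measurable]: "f \<in> measurable M P"
    and l [measurable]: "l \<in> borel_measurable M" and m [measurable]: "m \<in> borel_measurable M"
    and nonneg: "\<And>\<omega>. \<omega> \<in> space M \<Longrightarrow> 0 \<le> l \<omega>" "\<And>\<omega>. \<omega> \<in> space M \<Longrightarrow> 0 \<le> m \<omega>"
  shows "(\<lambda>\<omega>. dual_bid (l \<omega>) (m \<omega>) (val (f \<omega>))) \<in> borel_measurable M"
    and "(\<lambda>\<omega>. dual_value r (l \<omega>) (m \<omega>) (f \<omega>)) \<in> borel_measurable M"
proof -
  show b: "(\<lambda>\<omega>. dual_bid (l \<omega>) (m \<omega>) (val (f \<omega>))) \<in> borel_measurable M"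
    unfolding dual_bid_def by measurable
  have b0: "0 \<le> dual_bid (l \<omega>) (m \<omega>) (val (f \<omega>))" if "\<omega> \<in> space M" for \<omega>
    using truthful_bounds(1)[OF truthful[OF measurable_space[OF f that]] order_refl] nonneg[OF that]
    by (intro dual_bid_nonneg)
  note [measurable] = alloc_measurable[OF f b b0] pay_measurable[OF f b b0]
  show "(\<lambda>\<omega>. dual_value r (l \<omega>) (m \<omega>) (f \<omega>)) \<in> borel_measurable M"
    unfolding dual_value_def lagrangian_def by measurable
qed

lemma bidding_run:
  assumes "\<gamma> \<in> space PT"
  shows "bidding_run \<rho> T \<gamma>"
  by standard (use assms rho horizon in \<open>auto simp: space_PiM intro: truthful\<close>)

lemma state_measurable:
  assumes "t \<le> T"
  shows "(\<lambda>\<gamma>. ros_dual \<rho> T \<gamma> t) \<in> borel_measurable PT"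
    "(\<lambda>\<gamma>. budget_dual \<rho> T \<gamma> t) \<in> borel_measurable PT"
    "(\<lambda>\<gamma>. budget_left \<rho> T \<gamma> t) \<in> borel_measurable PT"
proof -
  have "(\<lambda>\<gamma>. ros_dual \<rho> T \<gamma> t) \<in> borel_measurable PT \<and>
    (\<lambda>\<gamma>. budget_dual \<rho> T \<gamma> t) \<in> borel_measurable PT \<and>
    (\<lambda>\<gamma>. budget_left \<rho> T \<gamma> t) \<in> borel_measurable PT"
    using assms
  proof (induction t)
    case 0
    then show ?case by (simp add: initial_state)
  next
    case (Suc t)
    then have [measurable]: "(\<lambda>\<gamma>. ros_dual \<rho> T \<gamma> t) \<in> borel_measurable PT"
      "(\<lambda>\<gamma>. budget_dual \<rho> T \<gamma> t) \<in> borel_measurable PT"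
      "(\<lambda>\<gamma>. budget_left \<rho> T \<gamma> t) \<in> borel_measurable PT"
      by auto
    have c [measurable]: "(\<lambda>\<gamma>. \<gamma> t) \<in> measurable PT P"
      using Suc by (intro measurable_component_singleton) auto
    have [measurable]: "(\<lambda>\<gamma>. dual_bid (ros_dual \<rho> T \<gamma> t) (budget_dual \<rho> T \<gamma> t) (val (\<gamma> t)))
        \<in> borel_measurable PT"
      by (intro dual_value_measurable(1)) (auto simp: budget_dual_nonneg less_imp_le[OF ros_dual_pos])
    have a: "(\<lambda>\<gamma>. algorithm_A \<rho> T \<gamma> t) \<in> borel_measurable PT"
      unfolding algorithm_A_eq by measurable
    have a0: "0 \<le> algorithm_A \<rho> T \<gamma> t" if "\<gamma> \<in> space PT" for \<gamma>
      using measurable_space[OF c that] by (intro algorithm_A_nonneg truthful)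
    note [measurable] = alloc_measurable[OF c a a0] pay_measurable[OF c a a0]
    show ?case
      unfolding next_state net_gain_def by (intro conjI) measurable
  qed
  then show "(\<lambda>\<gamma>. ros_dual \<rho> T \<gamma> t) \<in> borel_measurable PT"
    "(\<lambda>\<gamma>. budget_dual \<rho> T \<gamma> t) \<in> borel_measurable PT"
    "(\<lambda>\<gamma>. budget_left \<rho> T \<gamma> t) \<in> borel_measurable PT"
    by auto
qed

text \<open>The value \<open>D\<close> of the overview. The range of \<open>l\<close> is open at 0,
  so the infimum need not be attained.\<close>

definition min_dual :: real where
  "min_dual = Inf {\<integral>\<gamma>. dual_value \<rho> l m \<gamma> \<partial>P | l m. 0 < l \<and> 0 \<le> m}"

lemma integrable_dual_value:
  assumes "0 < l" "0 \<le> m"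
  shows "integrable P (dual_value \<rho> l m)"
proof (rule integrable_const_bound[where B = "1 + l + m * \<rho>"])
  show "AE \<gamma> in P. norm (dual_value \<rho> l m \<gamma>) \<le> 1 + l + m * \<rho>"
    using dual_value_bounds[OF truthful assms] rho by (intro AE_I2) auto
  show "dual_value \<rho> l m \<in> borel_measurable P"
    using assms by (intro dual_value_measurable(2)[of "\<lambda>\<gamma>. \<gamma>"]) auto
qed

lemma min_dual_le:
  assumes "0 < l" "0 \<le> m"
  shows "min_dual \<le> (\<integral>\<gamma>. dual_value \<rho> l m \<gamma> \<partial>P)"
  unfolding min_dual_def
proof (rule cInf_lower)
  show "bdd_below {\<integral>\<gamma>. dual_value \<rho> l m \<gamma> \<partial>P | l m. 0 < l \<and> 0 \<le> m}"
    using dual_value_bounds(1)[OF truthful] rho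
    by (intro bdd_belowI[where m = 0]) (auto intro!: Bochner_Integration.integral_nonneg)
qed (use assms in blast)

text \<open>Take \<open>m = 0\<close> and let \<open>l\<close> tend to 0.\<close>

lemma min_dual_le_1: "min_dual \<le> 1"
proof (rule field_le_epsilon)
  fix e :: real assume e: "0 < e"
  have "min_dual \<le> (\<integral>\<gamma>. dual_value \<rho> e 0 \<gamma> \<partial>P)"
    using e by (intro min_dual_le) auto
  also have "\<dots> \<le> 1 + e"
    using e rho dual_value_bounds(2)[OF truthful, of _ e 0 \<rho>]
    by (intro integral_le_const integrable_dual_value AE_I2) auto
  finally show "min_dual \<le> 1 + e" .
qed

lemma min_dual_approx:
  assumes "0 < e"
  obtains l m where "0 < l" "0 \<le> m" "(\<integral>\<gamma>. dual_value \<rho> l m \<gamma> \<partial>P) < min_dual + e"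
proof -
  have "(\<integral>\<gamma>. dual_value \<rho> 1 0 \<gamma> \<partial>P) \<in> {\<integral>\<gamma>. dual_value \<rho> l m \<gamma> \<partial>P | l m. 0 < l \<and> 0 \<le> m}"
    by force
  then have "\<exists>r\<in>{\<integral>\<gamma>. dual_value \<rho> l m \<gamma> \<partial>P | l m. 0 < l \<and> 0 \<le> m}. r < min_dual + e"
    using assms unfolding min_dual_def by (intro cInf_lessD) auto
  then show ?thesis using that by blast
qed

section \<open>Averaging over independent rounds\<close>

lemma integral_dual_value_component:
  assumes "0 < l" "0 \<le> m" "t < T"
  shows "integrable PT (\<lambda>\<gamma>. dual_value \<rho> l m (\<gamma> t))"
    "(\<integral>\<gamma>. dual_value \<rho> l m (\<gamma> t) \<partial>PT) = (\<integral>\<gamma>. dual_value \<rho> l m \<gamma> \<partial>P)"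
proof -
  have c: "(\<lambda>\<gamma>. \<gamma> t) \<in> measurable PT P"
    using assms(3) by (intro measurable_component_singleton) auto
  have d: "distr PT P (\<lambda>\<gamma>. \<gamma> t) = P"
    using assms(3) prob_space_axioms by (intro distr_PiM_component) auto
  have i: "integrable P (dual_value \<rho> l m)"
    using assms by (intro integrable_dual_value)
  show "integrable PT (\<lambda>\<gamma>. dual_value \<rho> l m (\<gamma> t))"
    using integrable_distr[OF c, of "dual_value \<rho> l m"] i d by simp
  show "(\<integral>\<gamma>. dual_value \<rho> l m (\<gamma> t) \<partial>PT) = (\<integral>\<gamma>. dual_value \<rho> l m \<gamma> \<partial>P)"
    using integral_distr[OF c, of "dual_value \<rho> l m"] i d by simp
qed

text \<open>The summand of \<open>total_value_ge\<close> for \<open>D = min_dual\<close>. Activity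
  and multipliers are determined by earlier rounds, so it resembles an increment of a stopped
  submartingale.\<close>

definition excess :: "nat \<Rightarrow> (nat \<Rightarrow> request) \<Rightarrow> real" where
  "excess t \<gamma> = (if 1 \<le> budget_left \<rho> T \<gamma> t
     then dual_value \<rho> (ros_dual \<rho> T \<gamma> t) (budget_dual \<rho> T \<gamma> t) (\<gamma> t) - min_dual else 0)"

lemma integrable_excess:
  assumes "t < T"
  shows "integrable PT (excess t)"
proof (rule product.P.integrable_const_bound[where B = "1 + exp (real t) + real t * \<rho> + \<bar>min_dual\<bar>"])
  have [measurable]: "(\<lambda>\<gamma>. \<gamma> t) \<in> measurable PT P"
    using assms by (intro measurable_component_singleton) auto
  note [measurable] = state_measurable[OF less_imp_le[OF assms]]
  have [measurable]: "(\<lambda>\<gamma>. dual_value \<rho> (ros_dual \<rho> T \<gamma> t) (budget_dual \<rho> T \<gamma> t) (\<gamma> t))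
      \<in> borel_measurable PT"
    by (intro dual_value_measurable(2)) (auto simp: budget_dual_nonneg less_imp_le[OF ros_dual_pos])
  show "excess t \<in> borel_measurable PT"
    unfolding excess_def by measurable
  show "AE \<gamma> in PT. norm (excess t \<gamma>) \<le> 1 + exp (real t) + real t * \<rho> + \<bar>min_dual\<bar>"
  proof (rule AE_I2)
    fix \<gamma> assume "\<gamma> \<in> space PT"
    then interpret bidding_run \<rho> T \<gamma> by (rule bidding_run)
    have "0 \<le> dual_value \<rho> (l t) (m t) (\<gamma> t)" "dual_value \<rho> (l t) (m t) (\<gamma> t) \<le> 1 + l t + m t * \<rho>"
      using dual_value_bounds[OF truthful[OF assms] ros_dual_pos budget_dual_nonneg] rho by auto
    moreover have "l t \<le> exp (real t)" "m t * \<rho> \<le> real t * \<rho>"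
      using state_le[of t] assms rho by (auto intro: mult_right_mono)
    ultimately have "\<bar>dual_value \<rho> (l t) (m t) (\<gamma> t) - min_dual\<bar>
        \<le> 1 + exp (real t) + real t * \<rho> + \<bar>min_dual\<bar>"
      by linarith
    moreover have "0 \<le> 1 + exp (real t) + real t * \<rho> + \<bar>min_dual\<bar>"
      using rho by (intro add_nonneg_nonneg) auto
    ultimately show "norm (excess t \<gamma>) \<le> 1 + exp (real t) + real t * \<rho> + \<bar>min_dual\<bar>"
      by (simp add: excess_def)
  qed
qed

text \<open>Integrate over request \<open>t\<close> first. The state before round \<open>t\<close>
  ignores that coordinate, so the inner integral is 0 or an expected dual value at fixed multipliers
  minus the infimum of such values.\<close>

lemma integral_excess_nonneg:
  assumes "t < T"
  shows "0 \<le> (\<integral>\<gamma>. excess t \<gamma> \<partial>PT)"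
proof -
  let ?J = "{..<T} - {t}"
  have J: "insert t ?J = {..<T}"
    using assms by auto
  have "(\<integral>\<gamma>. excess t \<gamma> \<partial>PT) =
      (\<integral>\<gamma>. (\<integral>\<gamma>'. excess t (\<gamma>(t := \<gamma>')) \<partial>P) \<partial>Pi\<^sub>M ?J (\<lambda>_. P))"
    using product.product_integral_insert[of ?J t "excess t"] integrable_excess[OF assms]
    unfolding J by simp
  also have "0 \<le> \<dots>"
  proof (rule Bochner_Integration.integral_nonneg)
    fix \<gamma> :: "nat \<Rightarrow> request"
    have s: "state \<rho> T (\<gamma>(t := \<gamma>')) t = state \<rho> T \<gamma> t" for \<gamma>'
      by (rule state_cong) simp
    have "excess t (\<gamma>(t := \<gamma>')) = (if 1 \<le> budget_left \<rho> T \<gamma> t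
       then dual_value \<rho> (ros_dual \<rho> T \<gamma> t) (budget_dual \<rho> T \<gamma> t) \<gamma>' - min_dual else 0)" for \<gamma>'
      by (simp add: excess_def ros_dual_def budget_dual_def budget_left_def s)
    then show "0 \<le> (\<integral>\<gamma>'. excess t (\<gamma>(t := \<gamma>')) \<partial>P)"
      using min_dual_le[OF ros_dual_pos budget_dual_nonneg, of \<rho> T \<gamma> t \<rho> T \<gamma> t]
        integrable_dual_value[OF ros_dual_pos budget_dual_nonneg, of \<rho> T \<gamma> t \<rho> T \<gamma> t]
      by (cases "1 \<le> budget_left \<rho> T \<gamma> t") (simp_all add: prob_space)
  qed
  finally show ?thesis .
qed

lemma regret_le:
  "regret (algorithm_A \<rho> T) \<rho> T P \<le>
     (13 + (1 + \<rho>\<^sup>2) / (2 * \<rho>\<^sup>2)) * sqrt (real T) + 1 / \<rho> + 1"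
proof -
  let ?K = "(13 + (1 + \<rho>\<^sup>2) / (2 * \<rho>\<^sup>2)) * sqrt (real T) + 1 / \<rho>"
  \<comment> \<open>A gap of \<open>1 / T\<close> per round costs 1 in total.\<close>
  obtain l m where lm: "0 < l" "0 \<le> m" "(\<integral>\<gamma>. dual_value \<rho> l m \<gamma> \<partial>P) < min_dual + 1 / real T"
    using min_dual_approx[of "1 / real T"] horizon by auto
  \<comment> \<open>An integrable majorant of the regret: weak duality at the fixed multipliers
    bounds the optimum, \<open>total_value_ge\<close> the reward collected.\<close>
  define Z where "Z \<gamma> = (\<Sum>t<T. dual_value \<rho> l m (\<gamma> t)) - (\<Sum>t<T. excess t \<gamma>)
    - real T * min_dual + ?K" for \<gamma>
  note dv = integral_dual_value_component[OF lm(1,2)]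
  have int_dual: "integrable PT (\<lambda>\<gamma>. \<Sum>t<T. dual_value \<rho> l m (\<gamma> t))"
    using dv(1) by (intro Bochner_Integration.integrable_sum) auto
  have int_excess: "integrable PT (\<lambda>\<gamma>. \<Sum>t<T. excess t \<gamma>)"
    using integrable_excess by (intro Bochner_Integration.integrable_sum) auto
  have int_Z: "integrable PT Z"
    unfolding Z_def using int_dual int_excess by simp
  have "regret (algorithm_A \<rho> T) \<rho> T P \<le> integral\<^sup>L PT Z"
    unfolding regret_def
  proof (rule upper_expectation_le[where c = "- real T"])
    show "prob_space PT"
      by (rule product.P.prob_space_axioms)
    show "AE \<gamma> in PT. reward_opt \<rho> T \<gamma> - total_value T \<gamma> (algorithm_A \<rho> T \<gamma>) \<le> Z \<gamma>"
    proof (rule AE_I2)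
      fix \<gamma> assume "\<gamma> \<in> space PT"
      then interpret r: bidding_run \<rho> T \<gamma> by (rule bidding_run)
      have "reward_opt \<rho> T \<gamma> \<le> (\<Sum>t<T. dual_value \<rho> l m (\<gamma> t))"
        unfolding dual_value_def using r.truthful lm rho by (intro reward_opt_le_dual) auto
      then show "reward_opt \<rho> T \<gamma> - total_value T \<gamma> (algorithm_A \<rho> T \<gamma>) \<le> Z \<gamma>"
        using r.total_value_ge[OF min_dual_le_1] unfolding Z_def excess_def by linarith
    qed
    show "AE \<gamma> in PT. - real T \<le> reward_opt \<rho> T \<gamma> - total_value T \<gamma> (algorithm_A \<rho> T \<gamma>)"
    proof (rule AE_I2)
      fix \<gamma> assume "\<gamma> \<in> space PT"
      then interpret r: bidding_run \<rho> T \<gamma> by (rule bidding_run)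
      have "total_value T \<gamma> r.a \<le> (\<Sum>t<T. 1)"
        unfolding total_value_def
      proof (rule sum_mono)
        fix t assume "t \<in> {..<T}"
        then have "truthful (\<gamma> t)" using r.truthful by simp
        moreover from this have "0 \<le> r.a t" by (rule algorithm_A_nonneg)
        ultimately show "val (\<gamma> t) * r.x t \<le> 1" by (rule truthful_bounds(8))
      qed
      moreover have "0 \<le> reward_opt \<rho> T \<gamma>"
        using r.truthful rho by (intro reward_opt_nonneg) auto
      ultimately show "- real T \<le> reward_opt \<rho> T \<gamma> - total_value T \<gamma> r.a"
        by simp
    qed
  qed (rule int_Z)
  also have "integral\<^sup>L PT Z = (\<integral>\<gamma>. (\<Sum>t<T. dual_value \<rho> l m (\<gamma> t)) \<partial>PT)
      - (\<integral>\<gamma>. (\<Sum>t<T. excess t \<gamma>) \<partial>PT) - real T * min_dual + ?K"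
    unfolding Z_def using int_dual int_excess by (simp add: product.P.prob_space)
  also have "\<dots> \<le> real T * (min_dual + 1 / real T) - 0 - real T * min_dual + ?K"
  proof (intro add_right_mono diff_mono order_refl)
    have "(\<integral>\<gamma>. (\<Sum>t<T. dual_value \<rho> l m (\<gamma> t)) \<partial>PT) =
        (\<Sum>t<T. \<integral>\<gamma>. dual_value \<rho> l m (\<gamma> t) \<partial>PT)"
      by (rule Bochner_Integration.integral_sum) (use dv(1) in auto)
    also have "\<dots> = real T * (\<integral>\<gamma>. dual_value \<rho> l m \<gamma> \<partial>P)"
      using dv(2) by simp
    also have "\<dots> \<le> real T * (min_dual + 1 / real T)"
      using lm(3) by (intro mult_left_mono) auto
    finally show "(\<integral>\<gamma>. (\<Sum>t<T. dual_value \<rho> l m (\<gamma> t)) \<partial>PT) \<le> \<dots>" .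
    have "(\<integral>\<gamma>. (\<Sum>t<T. excess t \<gamma>) \<partial>PT) = (\<Sum>t<T. \<integral>\<gamma>. excess t \<gamma> \<partial>PT)"
      by (rule Bochner_Integration.integral_sum) (use integrable_excess in auto)
    also have "\<dots> \<ge> 0"
      using integral_excess_nonneg by (intro sum_nonneg) auto
    finally show "0 \<le> (\<integral>\<gamma>. (\<Sum>t<T. excess t \<gamma>) \<partial>PT)" .
  qed
  also have "\<dots> = ?K + 1"
    using horizon by (simp add: field_simps)
  finally show ?thesis by simp
qed

end

theorem theorem5p1:
  fixes \<rho> :: real
  assumes "\<rho> > 0"
  shows "\<exists>C::real. \<forall>P T. request_distribution P \<longrightarrow> T \<ge> 2 \<longrightarrow>
    regret (algorithm_A \<rho> T) \<rho> T P \<le> C * sqrt (real T) \<and>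
    (\<forall>\<gamma>\<in>space (Pi\<^sub>M {..<T} (\<lambda>_. P)).
       total_payment T \<gamma> (algorithm_A \<rho> T \<gamma>) - total_value T \<gamma> (algorithm_A \<rho> T \<gamma>)
         \<le> C * sqrt (real T) * ln (real T) \<and>
       total_payment T \<gamma> (algorithm_A \<rho> T \<gamma>) \<le> \<rho> * real T)"
proof (intro exI allI impI conjI ballI)
  \<comment> \<open>The lower-order terms \<open>1 / \<rho> + 1\<close> are absorbed using
    \<open>sqrt T \<ge> 1\<close>, which turns 13 into 14.\<close>
  let ?C = "14 + (1 + \<rho>\<^sup>2) / (2 * \<rho>\<^sup>2) + 1 / \<rho>"
  fix P and T :: nat
  assume "request_distribution P" "2 \<le> T"
  then interpret iid_requests P \<rho> T
    using assms by unfold_locales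
  have "(1 / \<rho> + 1) * 1 \<le> (1 / \<rho> + 1) * sqrt (real T)"
    using assms horizon by (intro mult_left_mono) auto
  with regret_le show "regret (algorithm_A \<rho> T) \<rho> T P \<le> ?C * sqrt (real T)"
    by (simp add: algebra_simps)
  fix \<gamma> assume "\<gamma> \<in> space PT"
  then interpret r: bidding_run \<rho> T \<gamma> by (rule bidding_run)
  have "5 / 2 \<le> ?C"
    using assms by (simp add: add_increasing2)
  then have "5 / 2 * (sqrt (real T) * ln (real T)) \<le> ?C * (sqrt (real T) * ln (real T))"
    using horizon by (intro mult_right_mono) auto
  then have "5 / 2 * sqrt (real T) * ln (real T) \<le> ?C * sqrt (real T) * ln (real T)"
    by (simp only: mult.assoc)
  with r.ros_violation_le
  show "total_payment T \<gamma> (algorithm_A \<rho> T \<gamma>) - total_value T \<gamma> (algorithm_A \<rho> T \<gamma>)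
      \<le> ?C * sqrt (real T) * ln (real T)"
    by (rule order_trans)
  show "total_payment T \<gamma> (algorithm_A \<rho> T \<gamma>) \<le> \<rho> * real T"
    by (rule r.total_payment_le_budget)
qed

end
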